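(* Each of the complexity classes $\mathbf{NP}$, $\mathbf{EXP}$, $\mathbf{coNP}$, $\mathbf{BQP}$, $\mathbf{PH}$, $\mathbf{L}$, $\mathbf{NL}$, $\mathbf{PSPACE}$, viewed as a set of languages and hence as a subset of $2^\omega$, is $\boldsymbol{\Sigma}^0_2$-complete (it belongs to $\boldsymbol{\Sigma}^0_2$ but not to $\boldsymbol{\Pi}^0_2$).
   Context: Binary strings are identified with natural numbers via a fixed effective enumeration of $\{0,1\}^{<\omega}$, so that a language is identified with an element of the Cantor space $2^\omega$ (product topology). $\boldsymbol{\Sigma}^0_2$ is the class of countable unions of closed subsets of $2^\omega$; $\boldsymbol{\Pi}^0_2$ the class of countable intersections of open sets. *)

theory Defs
  imports "HOL-Analysis.Analysis" "HOL-Library.Landau_Symbols"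
    "HOL-Computational_Algebra.Polynomial"
begin

section \<open>Languages as points of Cantor space\<close>

type_synonym language = "bool list set"

text \<open>The length-lexicographic enumeration \<open>[]\<close>, \<open>0\<close>, \<open>1\<close>, \<open>00\<close>, \<open>01\<close>, \<open>10\<close>, \<open>11\<close>, \<open>000\<close>, ...
  of all binary strings.\<close>

fun nth_string :: "nat \<Rightarrow> bool list" where
  "nth_string n = (if n = 0 then [] else nth_string ((n - 1) div 2) @ [even n])"

declare nth_string.simps [simp del]

lemma bij_nth_string: "bij nth_string"
proof (rule bijI)
  show "inj nth_string"
  proof (rule injI)
    fix m n
    show "nth_string m = nth_string n \<Longrightarrow> m = n"
    proof (induction m arbitrary: n rule: less_induct)
      case (less m)
      show ?case
      proof (cases "m = 0 \<or> n = 0")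
        case True
        then show ?thesis
          using less.prems by (auto simp: nth_string.simps[of m] nth_string.simps[of n] split: if_splits)
      next
        case False
        then have "nth_string ((m - 1) div 2) = nth_string ((n - 1) div 2)" and par: "even m = even n"
          using less.prems by (simp_all add: nth_string.simps[of m] nth_string.simps[of n])
        moreover have "(m - 1) div 2 < m" using False by linarith
        ultimately have "(m - 1) div 2 = (n - 1) div 2" using less.IH by blast
        with par False show ?thesis by presburger
      qed
    qed
  qed
  have "\<exists>n. nth_string n = w" for w
  proof (induction w rule: rev_induct)
    case Nil
    show ?case by (rule exI[of _ 0]) (simp add: nth_string.simps)
  next
    case (snoc b w)
    then obtain n where n: "nth_string n = w" by blast
    have "nth_string (2 * n + (if b then 2 else 1)) = w @ [b]"
      using n by (subst nth_string.simps) simp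
    then show ?case by blast
  qed
  then show "surj nth_string" by (metis surjI)
qed

definition cantor_point :: "language \<Rightarrow> (nat \<Rightarrow> bool)" where
  "cantor_point A = (\<lambda>n. nth_string n \<in> A)"

definition cantor_set :: "language set \<Rightarrow> (nat \<Rightarrow> bool) set" where
  "cantor_set C = cantor_point ` C"

text \<open>Here \<^typ>\<open>nat \<Rightarrow> bool\<close> carries the product of the discrete topologies, and \<^const>\<open>fsigma\<close>,
  \<^const>\<open>gdelta\<close> are the boldface classes \<open>\<Sigma>\<^sup>0\<^sub>2\<close>, \<open>\<Pi>\<^sup>0\<^sub>2\<close>.
  Completeness is with respect to continuous (Wadge) reductions.\<close>

definition Sigma02_complete :: "(nat \<Rightarrow> bool) set \<Rightarrow> bool" where
  "Sigma02_complete A \<longleftrightarrow> fsigma A \<and>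
     (\<forall>B :: (nat \<Rightarrow> bool) set. fsigma B \<longrightarrow>
        (\<exists>f :: (nat \<Rightarrow> bool) \<Rightarrow> (nat \<Rightarrow> bool). continuous_on UNIV f \<and> (\<forall>x. x \<in> B \<longleftrightarrow> f x \<in> A)))"


section \<open>Turing machines\<close>

text \<open>Nondeterministic machines with a two-way read-only input tape, delimited by end markers, and
  one one-way infinite read-write work tape. The work symbols are natural numbers, with \<open>0\<close> the
  blank; since the program is a finite list of rules, each machine uses only finitely many states
  and symbols. A machine halts when no rule applies, and accepts if it halts in its accepting
  state.\<close>

datatype direction = Leftward | Stay | Rightward

datatype input_symbol = LeftEnd | RightEnd | Bit bool

type_synonym rule = "(nat \<times> input_symbol \<times> nat) \<times> (nat \<times> nat \<times> direction \<times> direction)"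

datatype machine = Machine (initial_state: nat) (accepting_state: nat) (rules: "rule list")

datatype config = Config (state: nat) (input_head: nat) (work_tape: "nat \<Rightarrow> nat") (work_head: nat)

text \<open>Input cell \<open>0\<close> holds the left end marker, cells \<open>1, ..., |x|\<close> the input \<open>x\<close>, and cell
  \<open>|x| + 1\<close> the right end marker, beyond which the input head cannot move.\<close>

definition input_cell :: "bool list \<Rightarrow> nat \<Rightarrow> input_symbol" where
  "input_cell x i = (if i = 0 then LeftEnd else if i \<le> length x then Bit (x ! (i - 1)) else RightEnd)"

fun move :: "direction \<Rightarrow> nat \<Rightarrow> nat" where
  "move Leftward i = i - 1"
| "move Stay i = i"
| "move Rightward i = i + 1"

definition initial_config :: "machine \<Rightarrow> config" where
  "initial_config M = Config (initial_state M) 0 (\<lambda>_. 0) 0"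

inductive step :: "machine \<Rightarrow> bool list \<Rightarrow> config \<Rightarrow> config \<Rightarrow> bool" for M x where
  "((q, input_cell x i, t j), (q', s, d, e)) \<in> set (rules M) \<Longrightarrow>
     step M x (Config q i t j) (Config q' (min (move d i) (length x + 1)) (t(j := s)) (move e j))"

definition reachable :: "machine \<Rightarrow> bool list \<Rightarrow> config \<Rightarrow> bool" where
  "reachable M x c \<longleftrightarrow> (step M x)\<^sup>*\<^sup>* (initial_config M) c"

definition halted :: "machine \<Rightarrow> bool list \<Rightarrow> config \<Rightarrow> bool" where
  "halted M x c \<longleftrightarrow> (\<nexists>c'. step M x c c')"

definition accepts :: "machine \<Rightarrow> bool list \<Rightarrow> bool" where
  "accepts M x \<longleftrightarrow> (\<exists>c. reachable M x c \<and> halted M x c \<and> state c = accepting_state M)"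

definition recognized :: "machine \<Rightarrow> language" where
  "recognized M = {x. accepts M x}"

definition deterministic :: "machine \<Rightarrow> bool" where
  "deterministic M \<longleftrightarrow> (\<forall>l r r'. (l, r) \<in> set (rules M) \<longrightarrow> (l, r') \<in> set (rules M) \<longrightarrow> r = r')"

text \<open>Resource bounds apply to every computation branch; in particular all branches halt.\<close>

definition runs_in_time :: "machine \<Rightarrow> (nat \<Rightarrow> nat) \<Rightarrow> bool" where
  "runs_in_time M T \<longleftrightarrow>
     (\<forall>x m c. (step M x ^^ m) (initial_config M) c \<longrightarrow> m \<le> T (length x))"

definition always_halts :: "machine \<Rightarrow> bool" where
  "always_halts M \<longleftrightarrow>
     (\<forall>x. \<exists>b. \<forall>m c. (step M x ^^ m) (initial_config M) c \<longrightarrow> m \<le> b)"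

text \<open>The work head starts at cell \<open>0\<close>, so \<open>work_head c < S n\<close> throughout means that at most
  \<open>S n\<close> work cells are visited.\<close>

definition runs_in_space :: "machine \<Rightarrow> (nat \<Rightarrow> nat) \<Rightarrow> bool" where
  "runs_in_space M S \<longleftrightarrow> always_halts M \<and>
     (\<forall>x c. reachable M x c \<longrightarrow> work_head c < S (length x))"


section \<open>Classical complexity classes\<close>

definition NTIME :: "(nat \<Rightarrow> real) \<Rightarrow> language set" where
  "NTIME f = {recognized M | M T. runs_in_time M T \<and> (\<lambda>n. real (T n)) \<in> O(f)}"

definition DTIME :: "(nat \<Rightarrow> real) \<Rightarrow> language set" where
  "DTIME f = {recognized M | M T. deterministic M \<and> runs_in_time M T \<and> (\<lambda>n. real (T n)) \<in> O(f)}"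

definition NSPACE :: "(nat \<Rightarrow> real) \<Rightarrow> language set" where
  "NSPACE f = {recognized M | M S. runs_in_space M S \<and> (\<lambda>n. real (S n)) \<in> O(f)}"

definition DSPACE :: "(nat \<Rightarrow> real) \<Rightarrow> language set" where
  "DSPACE f = {recognized M | M S. deterministic M \<and> runs_in_space M S \<and> (\<lambda>n. real (S n)) \<in> O(f)}"

definition class_P :: "language set" where
  "class_P = (\<Union>k::nat. DTIME (\<lambda>n. real n ^ k))"

definition class_NP :: "language set" where
  "class_NP = (\<Union>k::nat. NTIME (\<lambda>n. real n ^ k))"

definition class_coNP :: "language set" where
  "class_coNP = {A. - A \<in> class_NP}"

definition class_EXP :: "language set" where
  "class_EXP = (\<Union>k::nat. DTIME (\<lambda>n. 2 ^ (n ^ k)))"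

definition class_PSPACE :: "language set" where
  "class_PSPACE = (\<Union>k::nat. DSPACE (\<lambda>n. real n ^ k))"

definition class_L :: "language set" where
  "class_L = DSPACE (\<lambda>n. ln (real n))"

definition class_NL :: "language set" where
  "class_NL = NSPACE (\<lambda>n. ln (real n))"


section \<open>The polynomial hierarchy\<close>

text \<open>A self-delimiting encoding of tuples of strings: each bit is preceded by \<open>1\<close>, and each
  string is terminated by \<open>0\<close>.\<close>

definition encode_tuple :: "bool list list \<Rightarrow> bool list" where
  "encode_tuple us = concat (map (\<lambda>u. concat (map (\<lambda>b. [True, b]) u) @ [False]) us)"

text \<open>\<open>alternation True i m R [x]\<close> is
  \<open>\<exists>u\<^sub>1 \<in> {0,1}\<^sup>m. \<forall>u\<^sub>2 \<in> {0,1}\<^sup>m. ... Q u\<^sub>i \<in> {0,1}\<^sup>m. R [x, u\<^sub>1, ..., u\<^sub>i]\<close>.\<close>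

primrec alternation ::
  "bool \<Rightarrow> nat \<Rightarrow> nat \<Rightarrow> (bool list list \<Rightarrow> bool) \<Rightarrow> bool list list \<Rightarrow> bool"
where
  "alternation ex 0 m R us = R us"
| "alternation ex (Suc i) m R us =
     (if ex then \<exists>u. length u = m \<and> alternation False i m R (us @ [u])
      else \<forall>u. length u = m \<longrightarrow> alternation True i m R (us @ [u]))"

definition SigmaP :: "nat \<Rightarrow> language set" where
  "SigmaP i =
     {{x. alternation True i (poly q (length x)) (\<lambda>us. encode_tuple us \<in> B) [x]}
      | (B :: language) (q :: nat poly). B \<in> class_P}"

definition class_PH :: "language set" where
  "class_PH = (\<Union>i\<in>{1..}. SigmaP i)"


section \<open>Bounded-error quantum polynomial time\<close>

text \<open>Circuits over the universal gate set of Hadamard, \<open>\<pi>/8\<close> and controlled-not gates; the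
  (exactly expressible) gates \<open>X\<close> and Toffoli are included for convenience. The last argument of
  \<open>CNot\<close> and \<open>Toffoli\<close> is the target qubit.\<close>

datatype gate = PauliX nat | Hadamard nat | PhaseT nat | CNot nat nat | Toffoli nat nat nat

text \<open>The number of ancillary qubits, and the gates in order of application. On inputs of length \<open>n\<close>
  the qubits \<open>0, ..., n - 1\<close> hold the input, and the first ancilla, qubit \<open>n\<close>, is the output.\<close>

datatype circuit = Circuit (ancillas: nat) (gates: "gate list")

fun qubits :: "gate \<Rightarrow> nat list" where
  "qubits (PauliX i) = [i]"
| "qubits (Hadamard i) = [i]"
| "qubits (PhaseT i) = [i]"
| "qubits (CNot i j) = [i, j]"
| "qubits (Toffoli i j k) = [i, j, k]"

definition wf_circuit :: "nat \<Rightarrow> circuit \<Rightarrow> bool" where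
  "wf_circuit n Q \<longleftrightarrow> ancillas Q > 0 \<and>
     (\<forall>g\<in>set (gates Q). distinct (qubits g) \<and> (\<forall>i\<in>set (qubits g). i < n + ancillas Q))"

text \<open>A state of \<open>m\<close> qubits is given by its amplitudes at the basis states, the bit lists \<open>b\<close> of
  length \<open>m\<close>. For the permutation gates, which are involutions, the new amplitude at \<open>b\<close> is the old
  one at the image of \<open>b\<close>.\<close>

type_synonym qstate = "bool list \<Rightarrow> complex"

fun apply_gate :: "gate \<Rightarrow> qstate \<Rightarrow> qstate" where
  "apply_gate (PauliX i) \<psi> = (\<lambda>b. \<psi> (b[i := (\<not> b ! i)]))"
| "apply_gate (Hadamard i) \<psi> =
     (\<lambda>b. (\<psi> (b[i := False]) + (if b ! i then - 1 else 1) * \<psi> (b[i := True])) / complex_of_real (sqrt 2))"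
| "apply_gate (PhaseT i) \<psi> = (\<lambda>b. (if b ! i then cis (pi / 4) else 1) * \<psi> b)"
| "apply_gate (CNot i j) \<psi> = (\<lambda>b. \<psi> (b[j := (b ! j \<noteq> b ! i)]))"
| "apply_gate (Toffoli i j k) \<psi> = (\<lambda>b. \<psi> (b[k := (b ! k \<noteq> (b ! i \<and> b ! j))]))"

definition input_state :: "circuit \<Rightarrow> bool list \<Rightarrow> qstate" where
  "input_state Q x = (\<lambda>b. if b = x @ replicate (ancillas Q) False then 1 else 0)"

definition output_state :: "circuit \<Rightarrow> bool list \<Rightarrow> qstate" where
  "output_state Q x = fold apply_gate (gates Q) (input_state Q x)"

definition accept_prob :: "circuit \<Rightarrow> bool list \<Rightarrow> real" where
  "accept_prob Q x =
     (\<Sum>b | length b = length x + ancillas Q \<and> b ! length x. (cmod (output_state Q x b))\<^sup>2)"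

definition encode_nat :: "nat \<Rightarrow> bool list" where
  "encode_nat n = replicate n True @ [False]"

fun encode_gate :: "gate \<Rightarrow> bool list" where
  "encode_gate (PauliX i) = encode_nat 0 @ encode_nat i"
| "encode_gate (Hadamard i) = encode_nat 1 @ encode_nat i"
| "encode_gate (PhaseT i) = encode_nat 2 @ encode_nat i"
| "encode_gate (CNot i j) = encode_nat 3 @ encode_nat i @ encode_nat j"
| "encode_gate (Toffoli i j k) = encode_nat 4 @ encode_nat i @ encode_nat j @ encode_nat k"

definition encode_circuit :: "circuit \<Rightarrow> bool list" where
  "encode_circuit Q = encode_nat (ancillas Q) @ concat (map encode_gate (gates Q))"

text \<open>Output convention: at halting the work tape contains the output string from cell \<open>0\<close> on, with
  \<open>1\<close> and \<open>2\<close> standing for the bits \<open>0\<close> and \<open>1\<close>, followed by blanks only.\<close>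

definition tape_of_string :: "bool list \<Rightarrow> nat \<Rightarrow> nat" where
  "tape_of_string w i = (if i < length w then (if w ! i then 2 else 1) else 0)"

definition outputs :: "machine \<Rightarrow> bool list \<Rightarrow> bool list \<Rightarrow> bool" where
  "outputs M x w \<longleftrightarrow> (\<exists>c. reachable M x c \<and> halted M x c \<and> work_tape c = tape_of_string w)"

text \<open>Polynomial-time uniformity: a description of the \<open>n\<close>-th circuit is computed from \<open>1\<^sup>n\<close>. As
  numbers are encoded in unary, this bounds the number of ancillas and gates polynomially.\<close>

definition poly_uniform :: "(nat \<Rightarrow> circuit) \<Rightarrow> bool" where
  "poly_uniform Q \<longleftrightarrow>
     (\<exists>M T (k::nat). deterministic M \<and> runs_in_time M T \<and> (\<lambda>n. real (T n)) \<in> O(\<lambda>n. real n ^ k) \<and>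
        (\<forall>n. outputs M (replicate n True) (encode_circuit (Q n))))"

definition class_BQP :: "language set" where
  "class_BQP =
     {A. \<exists>Q. poly_uniform Q \<and> (\<forall>n. wf_circuit n (Q n)) \<and>
        (\<forall>x\<in>A. accept_prob (Q (length x)) x \<ge> 2 / 3) \<and>
        (\<forall>x\<in>- A. accept_prob (Q (length x)) x \<le> 1 / 3)}"

end

theory Submission
  imports Defs
begin

text \<open>Each of the classes is countable, because its languages are determined by Turing machines, and
  contains all finite languages. These two properties suffice. A countable set \<open>{a\<^sub>0, a\<^sub>1, ...}\<close> is
  \<open>\<Sigma>\<^sup>0\<^sub>2\<close>. To reduce a union of closed sets \<open>F\<^sub>0, F\<^sub>1, ...\<close> to it, read \<open>x\<close> bit by bit, testing \<open>F\<^sub>0\<close>,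
  then \<open>F\<^sub>1\<close>, and so on, moving to the next set as soon as the bits seen rule out the present one.
  Output zeros, except that leaving \<open>F\<^sub>n\<close> produces a bit that differs from that of \<open>a\<^sub>n\<close> at the same
  position. If \<open>x\<close> lies in some \<open>F\<^sub>n\<close> then the output is eventually zero, and otherwise it differs from
  every \<open>a\<^sub>n\<close>. As the \<open>k\<close>-th output bit depends only on the input bits before position \<open>k\<close>, the reduction
  has a fixed point; if the countable set were \<open>\<Pi>\<^sup>0\<^sub>2\<close>, a reduction of its complement to it would
  contradict this.\<close>

section \<open>Countable dense subsets of Cantor space\<close>

text \<open>The only evidence against membership in \<open>F\<close> that finitely many bits of
  \<open>x\<close> can give; a closed set that misses \<open>x\<close> is always refuted in this way
  at some \<open>k\<close>.\<close>

definition avoids_prefix :: "(nat \<Rightarrow> bool) set \<Rightarrow> nat \<Rightarrow> (nat \<Rightarrow> bool) \<Rightarrow> bool" where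
  "avoids_prefix F k x \<longleftrightarrow> (\<forall>y. (\<forall>i<k. y i = x i) \<longrightarrow> y \<notin> F)"

text \<open>The stage is the least closed set not yet ruled out, except that it advances by at most one
  per position.\<close>

primrec stage :: "(nat \<Rightarrow> (nat \<Rightarrow> bool) set) \<Rightarrow> (nat \<Rightarrow> bool) \<Rightarrow> nat \<Rightarrow> nat" where
  "stage F x 0 = 0"
| "stage F x (Suc k) =
     (if avoids_prefix (F (stage F x k)) k x then Suc (stage F x k) else stage F x k)"

text \<open>Whenever the stage advances from \<open>n\<close> to \<open>n + 1\<close>, the output is made to differ from \<open>a n\<close>;
  all other output bits are \<open>0\<close>.\<close>

definition diag_map ::
  "(nat \<Rightarrow> (nat \<Rightarrow> bool) set) \<Rightarrow> (nat \<Rightarrow> nat \<Rightarrow> bool) \<Rightarrow> (nat \<Rightarrow> bool) \<Rightarrow> nat \<Rightarrow> bool" where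
  "diag_map F a x k \<longleftrightarrow> avoids_prefix (F (stage F x k)) k x \<and> \<not> a (stage F x k) k"

text \<open>The bound is strict, so that a causal map has a fixed point, computed bit by bit.\<close>

definition causal :: "((nat \<Rightarrow> bool) \<Rightarrow> nat \<Rightarrow> bool) \<Rightarrow> bool" where
  "causal f \<longleftrightarrow> (\<forall>x y k. (\<forall>i<k. x i = y i) \<longrightarrow> f x k = f y k)"

lemma avoids_prefix_cong:
  "(\<And>i. i < k \<Longrightarrow> x i = y i) \<Longrightarrow> avoids_prefix F k x = avoids_prefix F k y"
  by (simp add: avoids_prefix_def)

lemma avoids_prefix_mono:
  "avoids_prefix F k x \<Longrightarrow> k \<le> m \<Longrightarrow> avoids_prefix F m x"
  by (simp add: avoids_prefix_def)

lemma avoids_prefixD: "avoids_prefix F k x \<Longrightarrow> x \<notin> F"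
  by (auto simp: avoids_prefix_def)

lemma stage_cong:
  "(\<And>i. i < k \<Longrightarrow> x i = y i) \<Longrightarrow> stage F x k = stage F y k"
proof (induction k)
  case (Suc k)
  then have "stage F x k = stage F y k" by simp
  moreover have "avoids_prefix G k x = avoids_prefix G k y" for G
    using Suc.prems by (intro avoids_prefix_cong) simp
  ultimately show ?case by simp
qed simp

lemma causal_diag_map: "causal (diag_map F a)"
  unfolding causal_def
proof (intro allI impI)
  fix x y k assume eq: "\<forall>i<k. (x :: nat \<Rightarrow> bool) i = y i"
  then have "stage F x k = stage F y k" by (intro stage_cong) simp
  moreover have "avoids_prefix G k x = avoids_prefix G k y" for G
    using eq by (intro avoids_prefix_cong) simp
  ultimately show "diag_map F a x k = diag_map F a y k" by (simp add: diag_map_def)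
qed

section \<open>Cylinders, continuity and fixed points of causal maps\<close>

lemma open_cylinder: "open {y :: nat \<Rightarrow> bool. \<forall>i<k. y i = x i}"
  using product_topology_basis'[of "{..<k}" "\<lambda>i. {x i}" "\<lambda>i. i"]
  by (simp add: open_discrete Ball_def)

text \<open>A basic open box constrains only finitely many coordinates, so any \<open>k\<close>
  above all of them works.\<close>

lemma open_contains_cylinder:
  fixes U :: "(nat \<Rightarrow> bool) set"
  assumes "open U" "x \<in> U"
  obtains k where "\<forall>y. (\<forall>i<k. y i = x i) \<longrightarrow> y \<in> U"
proof -
  have "openin (product_topology (\<lambda>i. euclidean) UNIV) U"
    using assms(1) by (simp add: open_fun_def)
  from product_topology_open_contains_basis[OF this assms(2)] obtain X
    where X: "x \<in> Pi\<^sub>E UNIV X" "finite {i. X i \<noteq> UNIV}" "Pi\<^sub>E UNIV X \<subseteq> U"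
    by auto
  obtain k where "{i. X i \<noteq> UNIV} \<subseteq> {..<k}"
    using finite_nat_bounded[OF X(2)] by blast
  then have k: "X i = UNIV" if "\<not> i < k" for i
    using that by auto
  show ?thesis
  proof (rule that[of k], intro allI impI)
    fix y assume y: "\<forall>i<k. y i = x i"
    have "y i \<in> X i" for i
    proof (cases "i < k")
      case True then show ?thesis using y X(1) by auto
    next
      case False then show ?thesis using k by simp
    qed
    then show "y \<in> U" using X(3) by auto
  qed
qed

lemma continuous_on_causal:
  assumes "causal f"
  shows "continuous_on UNIV f"
proof (rule continuous_on_coordinatewise_then_product)
  fix k
  \<comment> \<open>\<open>B\<close> is arbitrary here: the \<open>k\<close>-th output bit is
    constant on the cylinder of length \<open>k\<close> around each point, hence locally
    constant.\<close>
  have "open ((\<lambda>x. f x k) -` B)" for B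
  proof (subst open_subopen, intro ballI)
    fix x assume "x \<in> (\<lambda>x. f x k) -` B"
    then have "{y. \<forall>i<k. y i = x i} \<subseteq> (\<lambda>x. f x k) -` B"
      using assms by (auto simp: causal_def)
    then show "\<exists>T. open T \<and> x \<in> T \<and> T \<subseteq> (\<lambda>x. f x k) -` B"
      by (intro exI[of _ "{y. \<forall>i<k. y i = x i}"]) (simp add: open_cylinder)
  qed
  then show "continuous_on UNIV (\<lambda>x. f x k)"
    by (simp add: continuous_on_open_vimage)
qed

lemma causal_fixed_point:
  assumes "causal f"
  obtains x where "f x = x"
proof -
  \<comment> \<open>After \<open>k\<close> rounds the positions below \<open>k\<close> are final;
    the others still hold the default \<open>False\<close>, which the bit \<open>f (s k) k\<close>
    cannot depend on.\<close>
  define s where "s = rec_nat (\<lambda>_. False) (\<lambda>k x. x(k := f x k))"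
  have s_Suc: "s (Suc k) = (s k)(k := f (s k) k)" for k
    by (simp add: s_def)
  define x where "x k = s (Suc k) k" for k
  have "i < k \<Longrightarrow> s k i = x i" for i k
    by (induction k) (auto simp: x_def s_Suc less_Suc_eq)
  then have "f (s k) k = f x k" for k
    using assms by (simp add: causal_def)
  then have "f x = x"
    by (auto simp: x_def[of k for k] s_Suc)
  then show ?thesis by (rule that)
qed

lemma closed_avoids_prefix:
  assumes "closed F" "x \<notin> F"
  obtains k where "avoids_prefix F k x"
proof -
  have "open (- F)" "x \<in> - F" using assms by auto
  then obtain k where "\<forall>y. (\<forall>i<k. y i = x i) \<longrightarrow> y \<in> - F"
    by (rule open_contains_cylinder)
  then have "avoids_prefix F k x" by (auto simp: avoids_prefix_def)
  then show ?thesis by (rule that)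
qed

section \<open>Correctness of the diagonal reduction\<close>

lemma stage_mono: "k \<le> m \<Longrightarrow> stage F x k \<le> stage F x m"
  by (rule lift_Suc_mono_le[of "stage F x"]) simp_all

text \<open>No prefix of \<open>x\<close> avoids a set containing \<open>x\<close>, so the stage
  never passes \<open>n\<close>. Every true output bit comes with an advance of the stage, so
  distinct true bits occur at distinct stages.\<close>

lemma finite_diag_map:
  assumes "x \<in> F n"
  shows "finite {k. diag_map F a x k}"
proof -
  have bound: "stage F x k \<le> n" for k
  proof (induction k)
    case (Suc k)
    have "stage F x k \<noteq> n" if "avoids_prefix (F (stage F x k)) k x"
      using that assms by (auto dest: avoids_prefixD)
    with Suc show ?case by (auto simp: Suc_le_eq)
  qed simp
  have "inj_on (stage F x) {k. diag_map F a x k}"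
  proof (rule linorder_inj_onI')
    fix k m assume "k \<in> {k. diag_map F a x k}" "k < m"
    then have "stage F x k < stage F x (Suc k)" "stage F x (Suc k) \<le> stage F x m"
      using stage_mono[of "Suc k" m F x] by (simp_all add: diag_map_def)
    then show "stage F x k \<noteq> stage F x m" by simp
  qed
  moreover have "finite (stage F x ` {k. diag_map F a x k})"
    by (rule finite_subset[of _ "{..n}"]) (auto simp: bound)
  ultimately show ?thesis by (rule finite_imageD[rotated])
qed

lemma stage_change:
  assumes "\<And>n. closed (F n)" "x \<notin> \<Union> (range F)"
  obtains k where "stage F x k = n" "avoids_prefix (F n) k x"
proof -
  have change: "\<exists>m\<ge>k. stage F x m = n \<and> avoids_prefix (F n) m x" if k: "stage F x k = n" for k n
  proof -
    obtain l where "avoids_prefix (F n) l x"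
      using closed_avoids_prefix[of "F n" x] assms by blast
    \<comment> \<open>The prefix of length \<open>l\<close> may rule out \<open>F n\<close> before
      stage \<open>n\<close> is even reached; lengthening it moves the evidence to a position from
      \<open>k\<close> on.\<close>
    then have ex: "avoids_prefix (F n) (k + l) x"
      by (rule avoids_prefix_mono) simp
    \<comment> \<open>By minimality the stage does not advance between \<open>k\<close> and
      \<open>k + d\<close>, so it is still \<open>n\<close> when \<open>F n\<close> is ruled
      out.\<close>
    define d where "d = (LEAST d. avoids_prefix (F n) (k + d) x)"
    have d: "avoids_prefix (F n) (k + d) x"
      unfolding d_def using ex by (rule LeastI)
    have "e \<le> d \<Longrightarrow> stage F x (k + e) = n" for e
    proof (induction e)
      case (Suc e)
      then have "\<not> avoids_prefix (F n) (k + e) x"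
        unfolding d_def using not_less_Least Suc_le_eq by blast
      with Suc show ?case by simp
    qed (simp add: k)
    with d show ?thesis by (intro exI[of _ "k + d"]) simp
  qed
  have "\<exists>k. stage F x k = n"
  proof (induction n)
    case 0
    show ?case by (rule exI[of _ 0]) simp
  next
    case (Suc n)
    then obtain k where "stage F x k = n" by blast
    from change[OF this] obtain m where "stage F x m = n" "avoids_prefix (F n) m x" by blast
    then show ?case by (intro exI[of _ "Suc m"]) simp
  qed
  with change that show ?thesis by blast
qed

lemma diag_map_neq:
  assumes "\<And>n. closed (F n)" "x \<notin> \<Union> (range F)"
  shows "diag_map F a x \<noteq> a n"
proof -
  obtain k where "stage F x k = n" "avoids_prefix (F n) k x"
    by (rule stage_change[OF assms])
  then have "diag_map F a x k \<noteq> a n k" by (simp add: diag_map_def)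
  then show ?thesis by auto
qed

lemma causal_reduction:
  assumes "countable A" and "{x. finite {n. x n}} \<subseteq> A" and "fsigma B"
  obtains f where "causal f" "\<forall>x. x \<in> B \<longleftrightarrow> f x \<in> A"
proof -
  obtain F where F: "\<And>n :: nat. closed (F n)" "B = \<Union> (range F)"
    using \<open>fsigma B\<close> unfolding fsigma.simps[of B] by blast
  have fin: "x \<in> A" if "finite {n. x n}" for x using that assms(2) by blast
  \<comment> \<open>The zero sequence shows that \<open>A\<close> is nonempty, so
    \<open>from_nat_into A\<close> enumerates exactly \<open>A\<close>.\<close>
  have "(\<lambda>_. False) \<in> A" by (rule fin) simp
  then have range: "range (from_nat_into A) = A"
    using \<open>countable A\<close> by (intro range_from_nat_into) auto
  show ?thesis
  proof (rule that)
    show "causal (diag_map F (from_nat_into A))" by (rule causal_diag_map)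
    show "\<forall>x. x \<in> B \<longleftrightarrow> diag_map F (from_nat_into A) x \<in> A"
    proof (intro allI iffI)
      fix x
      assume "x \<in> B"
      then obtain n where "x \<in> F n" using F(2) by blast
      then show "diag_map F (from_nat_into A) x \<in> A"
        by (intro fin finite_diag_map)
    next
      fix x
      assume *: "diag_map F (from_nat_into A) x \<in> A"
      show "x \<in> B"
      proof (rule ccontr)
        assume "x \<notin> B"
        then have "diag_map F (from_nat_into A) x \<noteq> from_nat_into A n" for n
          using F by (intro diag_map_neq) auto
        moreover obtain n where "diag_map F (from_nat_into A) x = from_nat_into A n"
          using * range by (metis imageE)
        ultimately show False by blast
      qed
    qed
  qed
qed

section \<open>Completeness of countable dense sets\<close>

lemma closed_singleton_cantor: "closed {x :: nat \<Rightarrow> bool}"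
proof -
  have "open {y :: nat \<Rightarrow> bool. y k \<noteq> x k}" for k
    using product_topology_basis'[of "{k}" "\<lambda>_. {\<not> x k}" "\<lambda>i. i"]
    by (simp add: open_discrete)
  then have "open (\<Union>k. {y. y k \<noteq> x k})" by blast
  also have "(\<Union>k. {y. y k \<noteq> x k}) = - {x}" by auto
  finally show ?thesis by (simp add: closed_def)
qed

lemma countable_imp_fsigma_cantor:
  fixes A :: "(nat \<Rightarrow> bool) set"
  assumes "countable A"
  shows "fsigma A"
proof (cases "A = {}")
  case True
  have "fsigma (\<Union> (range (\<lambda>_::nat. {} :: (nat \<Rightarrow> bool) set)))" by (rule fsigma.intros) simp
  with True show ?thesis by simp
next
  case False
  have "fsigma (\<Union> (range (\<lambda>n. {from_nat_into A n})))"
    by (intro fsigma.intros closed_singleton_cantor)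
  also have "\<Union> (range (\<lambda>n. {from_nat_into A n})) = A"
    using range_from_nat_into[OF False assms] by auto
  finally show ?thesis .
qed

proposition countable_Sigma02_complete:
  assumes "countable A" and "{x. finite {n. x n}} \<subseteq> A"
  shows "Sigma02_complete A" and "fsigma A" and "\<not> gdelta A"
proof -
  show "fsigma A" using assms(1) by (rule countable_imp_fsigma_cantor)
  then show "Sigma02_complete A"
    unfolding Sigma02_complete_def by (metis causal_reduction[OF assms] continuous_on_causal)
  show "\<not> gdelta A"
  proof
    assume "gdelta A"
    then have "fsigma (- A)" using gdelta_complement[of "- A"] by simp
    then obtain f where "causal f" "\<forall>x. x \<in> - A \<longleftrightarrow> f x \<in> A"
      by (rule causal_reduction[OF assms])
    moreover obtain x where "f x = x" using \<open>causal f\<close> by (rule causal_fixed_point)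
    ultimately show False by (metis ComplD ComplI)
  qed
qed

text \<open>As \<open>nth_string\<close> is a bijection, a finitely supported sequence is the point
  of a finite language. This turns closure under finite languages into the density
  condition.\<close>

lemma finite_cantor_set:
  assumes "\<And>A. finite A \<Longrightarrow> A \<in> C" "finite {n. x n}"
  shows "x \<in> cantor_set C"
proof -
  have "x = cantor_point (nth_string ` {n. x n})"
    using bij_nth_string by (auto simp: cantor_point_def bij_def inj_image_mem_iff)
  then show ?thesis using assms by (auto simp: cantor_set_def)
qed

section \<open>Turing machines that inspect a bounded prefix of the input\<close>

lemma step_deterministic:
  assumes "deterministic M" "step M x c d" "step M x c d'"
  shows "d = d'"
  using assms(2,3)
proof (cases rule: step.cases)
  case (1 q i t j q' s d e)
  note A = this
  from assms(3) show ?thesis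
  proof (cases rule: step.cases)
    case (1 q1 i1 t1 j1 q1' s1 d1 e1)
    with A assms(1) show ?thesis unfolding deterministic_def by (metis config.inject prod.inject)
  qed
qed

lemma reachable_halted_unique:
  assumes "deterministic M" "reachable M x c" "halted M x c" "reachable M x d" "halted M x d"
  shows "c = d"
proof -
  \<comment> \<open>The start \<open>b\<close> is left general so that the induction can peel off
    the first step, which both runs share by determinism.\<close>
  have "c = d" if "(step M x)\<^sup>*\<^sup>* b c" "(step M x)\<^sup>*\<^sup>* b d" for b
    using that
  proof (induction rule: converse_rtranclp_induct)
    case base
    then show ?case using \<open>halted M x c\<close>
      by (cases rule: converse_rtranclpE) (auto simp: halted_def)
  next
    case (step y z)
    note IH = step.IH and yz = step.hyps(1)
    from step.prems show ?case
    proof (cases rule: converse_rtranclpE)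
      case base
      then show ?thesis using step.hyps(1) \<open>halted M x d\<close> by (auto simp: halted_def)
    next
      case (step w)
      then show ?thesis
        using step_deterministic[OF assms(1) yz] IH by blast
    qed
  qed
  then show ?thesis using assms(2,4) unfolding reachable_def by blast
qed

datatype phase = Start | Read "bool list" | Emit bool "bool list"

instance phase :: countable by countable_datatype

text \<open>The phase \<open>Read u\<close> has read the prefix \<open>u\<close> of the input; \<open>Emit v w\<close> has reached the verdict \<open>v\<close>
  and still has to write \<open>w\<close>.\<close>

fun delta :: "nat \<Rightarrow> (bool list \<Rightarrow> bool) \<Rightarrow> (bool list \<Rightarrow> bool list) \<Rightarrow>
    phase \<Rightarrow> input_symbol \<Rightarrow> phase \<times> nat \<times> direction \<times> direction" where
  "delta K V W Start a = (Read [], 0, Rightward, Stay)"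
| "delta K V W (Read u) a =
     (if \<exists>b. a = Bit b \<and> length u < K then (Read (u @ [a = Bit True]), 0, Rightward, Stay)
      else (Emit (V u) (W u), 0, Stay, Stay))"
| "delta K V W (Emit v w) a = (Emit v (tl w), if hd w then 2 else 1, Stay, Rightward)"

text \<open>The phases \<open>Emit v []\<close> are excluded because the machine must halt there.\<close>

definition phases :: "nat \<Rightarrow> nat \<Rightarrow> phase set" where
  "phases K L = {Start} \<union> Read ` {u. length u \<le> K} \<union> {Emit v w | v w. w \<noteq> [] \<and> length w \<le> L}"

text \<open>Every rule expects a blank on the work tape: an output cell is written once, the head
  moves on, and nothing is read back. Numeric states are codes of phases.\<close>

definition phase_rules ::
  "nat \<Rightarrow> nat \<Rightarrow> (bool list \<Rightarrow> bool) \<Rightarrow> (bool list \<Rightarrow> bool list) \<Rightarrow> rule set" where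
  "phase_rules K L V W =
     (\<lambda>(p, a). ((to_nat p, a, 0), apfst to_nat (delta K V W p a))) ` (phases K L \<times> UNIV)"

text \<open>A program is a list, so some listing of the finite rule set is chosen. A rejecting run
  ends in the code of \<open>Emit False []\<close>, which differs from the accepting state.\<close>

definition prefix_machine ::
  "nat \<Rightarrow> nat \<Rightarrow> (bool list \<Rightarrow> bool) \<Rightarrow> (bool list \<Rightarrow> bool list) \<Rightarrow> machine" where
  "prefix_machine K L V W =
     Machine (to_nat Start) (to_nat (Emit True [])) (SOME rs. set rs = phase_rules K L V W)"

lemma finite_phases: "finite (phases K L)"
proof -
  have fin: "finite {u :: bool list. length u \<le> n}" for n
    using finite_lists_length_le[of "UNIV :: bool set" n] by simp
  have "{Emit v w | v w. w \<noteq> [] \<and> length w \<le> L} \<subseteq> (\<lambda>(v, w). Emit v w) ` (UNIV \<times> {w. length w \<le> L})"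
    by auto
  then have "finite {Emit v w | v w. w \<noteq> [] \<and> length w \<le> L}"
    by (rule finite_subset) (intro finite_imageI finite_cartesian_product fin finite)
  then show ?thesis using fin by (simp add: phases_def)
qed

lemma finite_UNIV_input_symbol: "finite (UNIV :: input_symbol set)"
proof -
  have "(UNIV :: input_symbol set) = {LeftEnd, RightEnd} \<union> range Bit"
    using input_symbol.exhaust by blast
  then show ?thesis by (metis finite.emptyI finite.insertI finite_Un finite_imageI finite)
qed

lemma set_rules_prefix_machine: "set (rules (prefix_machine K L V W)) = phase_rules K L V W"
proof -
  have "finite (phase_rules K L V W)"
    unfolding phase_rules_def by (intro finite_imageI finite_cartesian_product finite_phases finite_UNIV_input_symbol)
  from someI_ex[OF finite_list[OF this]] show ?thesis by (simp add: prefix_machine_def)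
qed

lemma deterministic_prefix_machine: "deterministic (prefix_machine K L V W)"
  unfolding deterministic_def set_rules_prefix_machine
proof (intro allI impI)
  fix l r r' assume "(l, r) \<in> phase_rules K L V W" "(l, r') \<in> phase_rules K L V W"
  then obtain p a p' a' where "l = (to_nat p, a, 0)" "r = apfst to_nat (delta K V W p a)"
      "l = (to_nat p', a', 0)" "r' = apfst to_nat (delta K V W p' a')"
    unfolding phase_rules_def image_iff by auto
  then show "r = r'" by simp
qed

lemma step_prefix_machine:
  "step (prefix_machine K L V W) x (Config q i t j) c \<longleftrightarrow>
   (\<exists>p\<in>phases K L. \<exists>p' s d e. q = to_nat p \<and> t j = 0 \<and> delta K V W p (input_cell x i) = (p', s, d, e) \<and>
     c = Config (to_nat p') (min (move d i) (length x + 1)) (t(j := s)) (move e j))"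
  (is "?L \<longleftrightarrow> ?R")
proof
  assume ?L
  then obtain q' s d e where
    *: "((q, input_cell x i, t j), (q', s, d, e)) \<in> phase_rules K L V W"
       "c = Config q' (min (move d i) (length x + 1)) (t(j := s)) (move e j)"
    by (auto simp: step.simps set_rules_prefix_machine)
  from *(1) obtain p where "p \<in> phases K L" "q = to_nat p" "t j = 0"
      "(q', s, d, e) = apfst to_nat (delta K V W p (input_cell x i))"
    by (auto simp: phase_rules_def)
  moreover from this(4) obtain p' where "q' = to_nat p'" "delta K V W p (input_cell x i) = (p', s, d, e)"
    by (cases "delta K V W p (input_cell x i)") auto
  ultimately show ?R using *(2) by blast
next
  assume ?R
  then obtain p p' s d e where *: "p \<in> phases K L" "q = to_nat p" "t j = 0"
      "delta K V W p (input_cell x i) = (p', s, d, e)"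
      "c = Config (to_nat p') (min (move d i) (length x + 1)) (t(j := s)) (move e j)"
    by blast
  have "((q, input_cell x i, t j), (to_nat p', s, d, e)) \<in> phase_rules K L V W"
    unfolding phase_rules_def using *(1-4) by (intro image_eqI[of _ _ "(p, input_cell x i)"]) auto
  then show ?L unfolding *(5) by (intro step.intros) (simp add: set_rules_prefix_machine)
qed

text \<open>An upper bound on the steps still to come: the bits left to read, one step to switch
  from reading to writing, at most \<open>L\<close> symbols to write, and from \<open>Start\<close>
  one more step off the end marker.\<close>

fun phase_rank :: "nat \<Rightarrow> nat \<Rightarrow> phase \<Rightarrow> nat" where
  "phase_rank K L Start = K + L + 2"
| "phase_rank K L (Read u) = (K - length u) + L + 1"
| "phase_rank K L (Emit v w) = length w"

lemma runs_in_time_prefix_machine: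
  assumes "\<And>u. length u \<le> K \<Longrightarrow> length (W u) \<le> L"
  shows "runs_in_time (prefix_machine K L V W) (\<lambda>_. K + L + 2)"
proof -
  let ?r = "\<lambda>c. phase_rank K L (from_nat (state c))"
  let ?M = "prefix_machine K L V W"
  have dec: "?r d < ?r c" if st: "step ?M x c d" for x c d
  proof -
    obtain q i t j where c: "c = Config q i t j" by (cases c)
    with st obtain p p' s d' e where "p \<in> phases K L" "q = to_nat p"
      "delta K V W p (input_cell x i) = (p', s, d', e)" "state d = to_nat p'"
      by (auto simp: step_prefix_machine)
    moreover from this(1,3) have "phase_rank K L p' < phase_rank K L p"
    proof (cases p)
      case (Read u)
      then have "length u \<le> K" using \<open>p \<in> phases K L\<close> by (auto simp: phases_def)
      \<comment> \<open>At the switch to \<open>Emit\<close> the rank drops because the word to be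
        written has length at most \<open>L\<close>.\<close>
      with Read assms[of u] \<open>delta K V W p _ = _\<close> show ?thesis by (auto split: if_splits)
    qed (use \<open>p \<in> phases K L\<close> \<open>delta K V W p _ = _\<close> in \<open>auto simp: phases_def\<close>)
    ultimately show ?thesis by (simp add: c)
  qed
  have "(step ?M x ^^ m) c d \<Longrightarrow> ?r d + m \<le> ?r c" for x m c d
  proof (induction m arbitrary: d)
    case (Suc m)
    then obtain e where "(step ?M x ^^ m) c e" "step ?M x e d" by auto
    with Suc.IH[of e] dec[of x e d] show ?case by simp
  qed simp
  from this[of m x "initial_config ?M" for m x] show ?thesis
    unfolding runs_in_time_def
    by (fastforce simp: initial_config_def prefix_machine_def)
qed

text \<open>Cell \<open>0\<close> holds the left end marker, so after \<open>n\<close> bits the head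
  stands on cell \<open>Suc n\<close>.\<close>

lemma prefix_machine_reads:
  assumes "n \<le> K" "n \<le> length x"
  shows "reachable (prefix_machine K L V W) x (Config (to_nat (Read (take n x))) (Suc n) (\<lambda>_. 0) 0)"
  using assms
proof (induction n)
  case 0
  have "step (prefix_machine K L V W) x (initial_config (prefix_machine K L V W))
     (Config (to_nat (Read [])) (Suc 0) (\<lambda>_. 0) 0)"
    unfolding initial_config_def step_prefix_machine
    by (rule bexI[of _ Start]) (auto simp: phases_def prefix_machine_def)
  then show ?case by (simp add: reachable_def r_into_rtranclp)
next
  case (Suc n)
  then have "reachable (prefix_machine K L V W) x (Config (to_nat (Read (take n x))) (Suc n) (\<lambda>_. 0) 0)"
    by simp
  moreover have "step (prefix_machine K L V W) x (Config (to_nat (Read (take n x))) (Suc n) (\<lambda>_. 0) 0)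
     (Config (to_nat (Read (take (Suc n) x))) (Suc (Suc n)) (\<lambda>_. 0) 0)"
    unfolding step_prefix_machine
    using Suc.prems
    by (intro bexI[of _ "Read (take n x)"])
      (auto simp: phases_def input_cell_def take_Suc_conv_app_nth)
  ultimately show ?case unfolding reachable_def by (rule rtranclp.rtrancl_into_rtrancl)
qed

text \<open>Induction on the unwritten rest \<open>w\<close> with the written part \<open>u\<close>
  arbitrary: each step moves one symbol from \<open>w\<close> to \<open>u\<close>, and cell
  \<open>length u\<close> is still blank.\<close>

lemma prefix_machine_emits:
  assumes "length w \<le> L" "i \<le> length x + 1"
    and "reachable (prefix_machine K L V W) x (Config (to_nat (Emit v w)) i (tape_of_string u) (length u))"
  shows "reachable (prefix_machine K L V W) x
    (Config (to_nat (Emit v [])) i (tape_of_string (u @ w)) (length (u @ w)))"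
  using assms
proof (induction w arbitrary: u)
  case (Cons b w)
  have "(tape_of_string u)(length u := if b then 2 else 1) = tape_of_string (u @ [b])"
    by (auto simp: tape_of_string_def nth_append fun_eq_iff)
  then have "step (prefix_machine K L V W) x (Config (to_nat (Emit v (b # w))) i (tape_of_string u) (length u))
     (Config (to_nat (Emit v w)) i (tape_of_string (u @ [b])) (length (u @ [b])))"
    unfolding step_prefix_machine using Cons.prems(1,2)
    by (intro bexI[of _ "Emit v (b # w)"]) (auto simp: phases_def tape_of_string_def)
  with Cons.prems(3) have "reachable (prefix_machine K L V W) x
      (Config (to_nat (Emit v w)) i (tape_of_string (u @ [b])) (length (u @ [b])))"
    unfolding reachable_def by (rule rtranclp.rtrancl_into_rtrancl)
  from Cons.IH[OF _ _ this] Cons.prems(1,2) show ?case by simp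
qed simp

lemma prefix_machine_result:
  assumes "\<And>u. length u \<le> K \<Longrightarrow> length (W u) \<le> L"
  obtains i j where
    "reachable (prefix_machine K L V W) x
       (Config (to_nat (Emit (V (take K x)) [])) i (tape_of_string (W (take K x))) j)"
    "halted (prefix_machine K L V W) x
       (Config (to_nat (Emit (V (take K x)) [])) i (tape_of_string (W (take K x))) j)"
proof -
  let ?M = "prefix_machine K L V W" and ?u = "take K x"
  define n where "n = min K (length x)"
  have "take n x = ?u" by (simp add: n_def min_def)
  then have reads: "reachable ?M x (Config (to_nat (Read ?u)) (Suc n) (\<lambda>_. 0) 0)"
    using prefix_machine_reads[of n K x L V W] by (simp add: n_def)
  \<comment> \<open>Reading ends here: either \<open>K\<close> bits are stored in the state, or the
    head is on the right end marker.\<close>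
  have "\<not> (\<exists>b. input_cell x (Suc n) = Bit b \<and> length ?u < K)"
    by (auto simp: n_def input_cell_def)
  then have "step ?M x (Config (to_nat (Read ?u)) (Suc n) (\<lambda>_. 0) 0)
      (Config (to_nat (Emit (V ?u) (W ?u))) (Suc n) (\<lambda>_. 0) 0)"
    unfolding step_prefix_machine
    by (intro bexI[of _ "Read ?u"]) (auto simp: phases_def n_def)
  with reads have "reachable ?M x (Config (to_nat (Emit (V ?u) (W ?u))) (Suc n) (\<lambda>_. 0) 0)"
    unfolding reachable_def by (rule rtranclp.rtrancl_into_rtrancl)
  then have "reachable ?M x (Config (to_nat (Emit (V ?u) (W ?u))) (Suc n) (tape_of_string []) (length ([] :: bool list)))"
    by (simp add: tape_of_string_def[abs_def])
  from prefix_machine_emits[OF _ _ this] assms[of ?u] obtain i j where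
    reach: "reachable ?M x (Config (to_nat (Emit (V ?u) [])) i (tape_of_string (W ?u)) j)"
    by (auto simp: n_def)
  have "halted ?M x (Config (to_nat (Emit (V ?u) [])) i (tape_of_string (W ?u)) j)"
    by (auto simp: halted_def step_prefix_machine phases_def)
  with reach show ?thesis by (rule that)
qed

text \<open>One construction for two uses: the verdict decides languages, and the written word
  supplies descriptions of circuits.\<close>

lemma prefix_transducer:
  fixes V :: "bool list \<Rightarrow> bool" and W :: "bool list \<Rightarrow> bool list"
  obtains M c where "deterministic M" "runs_in_time M (\<lambda>_. c)"
    "\<forall>x. accepts M x \<longleftrightarrow> V (take K x)" "\<forall>x. outputs M x (W (take K x))"
proof -
  \<comment> \<open>There are finitely many prefixes of length at most \<open>K\<close>, so their
    outputs have a common length bound.\<close>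
  have "finite ((\<lambda>u. length (W u)) ` {u. length u \<le> K})"
    using finite_lists_length_le[of "UNIV :: bool set" K] by simp
  then obtain L where L: "\<And>u. length u \<le> K \<Longrightarrow> length (W u) \<le> L"
    unfolding finite_nat_set_iff_bounded_le by blast
  define M where "M = prefix_machine K L V W"
  have det: "deterministic M" unfolding M_def by (rule deterministic_prefix_machine)
  show ?thesis
  proof (rule that[of M "K + L + 2"])
    show "runs_in_time M (\<lambda>_. K + L + 2)"
      unfolding M_def using L by (rule runs_in_time_prefix_machine)
    have "outputs M x (W (take K x)) \<and> (accepts M x \<longleftrightarrow> V (take K x))" for x
    proof -
      obtain i j where
        "reachable M x (Config (to_nat (Emit (V (take K x)) [])) i (tape_of_string (W (take K x))) j)"
        "halted M x (Config (to_nat (Emit (V (take K x)) [])) i (tape_of_string (W (take K x))) j)"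
        unfolding M_def by (rule prefix_machine_result[OF L])
      note final = this
      from final have "outputs M x (W (take K x))"
        unfolding outputs_def by (intro exI conjI) auto
      \<comment> \<open>Acceptance is existential, so rejection requires that no other halting
        configuration is reachable.\<close>
      have "c = Config (to_nat (Emit (V (take K x)) [])) i (tape_of_string (W (take K x))) j"
        if "reachable M x c" "halted M x c" for c
        using reachable_halted_unique[OF det that final] .
      then have "accepts M x \<longleftrightarrow> to_nat (Emit (V (take K x)) []) = accepting_state M"
        unfolding accepts_def using final by (metis config.sel(1))
      then have "accepts M x \<longleftrightarrow> V (take K x)"
        by (simp add: M_def prefix_machine_def)
      with \<open>outputs M x _\<close> show ?thesis by blast
    qed
    then show "\<forall>x. accepts M x \<longleftrightarrow> V (take K x)" "\<forall>x. outputs M x (W (take K x))" by blast+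
  qed (rule det)
qed

text \<open>The work head starts at cell \<open>0\<close> and moves at most one cell per step; the
  \<open>+ 1\<close> makes the bound on its position strict.\<close>

lemma runs_in_time_imp_space:
  assumes "runs_in_time M T"
  shows "runs_in_space M (\<lambda>n. T n + 1)"
proof -
  have head: "(step M x ^^ m) (initial_config M) c \<Longrightarrow> work_head c \<le> m" for x m c
  proof (induction m arbitrary: c)
    case 0
    then have "c = initial_config M" by simp
    then show ?case by (simp add: initial_config_def)
  next
    case (Suc m)
    then obtain d where "(step M x ^^ m) (initial_config M) d" "step M x d c" by auto
    moreover from this(2) obtain e where "work_head c = move e (work_head d)"
      by (auto elim!: step.cases)
    moreover have "move e (work_head d) \<le> Suc (work_head d)" by (cases e) auto
    ultimately show ?case using Suc.IH[of d] by simp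
  qed
  have "work_head c < T (length x) + 1" if reach: "reachable M x c" for x c
  proof -
    obtain m where m: "(step M x ^^ m) (initial_config M) c"
      using reach by (auto simp: reachable_def rtranclp_power)
    with assms head[OF m] show ?thesis unfolding runs_in_time_def by fastforce
  qed
  moreover have "always_halts M"
    using assms unfolding always_halts_def runs_in_time_def by blast
  ultimately show ?thesis by (simp add: runs_in_space_def)
qed

lemma finite_language_prefix:
  assumes "finite (A :: language)"
  obtains K where "\<forall>x. take K x \<in> A \<longleftrightarrow> x \<in> A" "\<forall>x\<in>A. length x < K"
proof -
  obtain K where K: "\<And>x. x \<in> A \<Longrightarrow> length x < K"
    using finite_nat_bounded[of "length ` A"] assms by auto
  \<comment> \<open>If \<open>x\<close> has length at least \<open>K\<close>, then neither
    \<open>x\<close> nor its prefix of length exactly \<open>K\<close> is in \<open>A\<close>, since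
    all members are strictly shorter.\<close>
  have "take K x \<in> A \<longleftrightarrow> x \<in> A" for x
    using K[of "take K x"] K[of x] by (cases "length x < K") auto
  with K show ?thesis by (intro that[of K]) blast+
qed

text \<open>Such machines see only a bounded prefix of the input.\<close>

definition constant_time :: "language \<Rightarrow> bool" where
  "constant_time A \<longleftrightarrow>
     (\<exists>M c. deterministic M \<and> runs_in_time M (\<lambda>_. c) \<and> recognized M = A)"

lemma constant_time_prefix:
  assumes "\<And>x. take K x \<in> A \<longleftrightarrow> x \<in> A"
  shows "constant_time A"
proof -
  obtain M c where M: "deterministic M" "runs_in_time M (\<lambda>_. c)"
    and acc: "\<forall>x. accepts M x \<longleftrightarrow> take K x \<in> A"
    by (rule prefix_transducer[where V = "\<lambda>u. u \<in> A" and W = "\<lambda>_. []" and K = K])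
  have "recognized M = A" by (simp add: recognized_def acc assms)
  with M show ?thesis unfolding constant_time_def by blast
qed

lemma constant_time_finite:
  assumes "finite A"
  shows "constant_time A"
proof -
  obtain K where "\<forall>x. take K x \<in> A \<longleftrightarrow> x \<in> A"
    by (rule finite_language_prefix[OF assms])
  then show ?thesis by (intro constant_time_prefix[of K]) simp
qed

lemma constant_time_cofinite:
  assumes "finite A"
  shows "constant_time (- A)"
proof -
  obtain K where "\<forall>x. take K x \<in> A \<longleftrightarrow> x \<in> A"
    by (rule finite_language_prefix[OF assms])
  then show ?thesis by (intro constant_time_prefix[of K]) simp
qed

section \<open>Finite languages in the time and space classes and in PH\<close>

lemma constant_time_DTIME:
  assumes "constant_time A" "(\<lambda>_. 1) \<in> O(f)"
  shows "A \<in> DTIME f"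
proof -
  obtain M c where "deterministic M" "runs_in_time M (\<lambda>_. c)" "recognized M = A"
    using assms(1) by (auto simp: constant_time_def)
  moreover have "(\<lambda>n. real c) \<in> O(f)"
    by (rule landau_o.big_trans[OF bigo_const assms(2)])
  ultimately show ?thesis
    unfolding DTIME_def by (intro CollectI exI[of _ M] exI[of _ "\<lambda>_. c"]) auto
qed

lemma DTIME_subset_NTIME: "DTIME f \<subseteq> NTIME f"
  unfolding DTIME_def NTIME_def by blast

lemma DSPACE_subset_NSPACE: "DSPACE f \<subseteq> NSPACE f"
  unfolding DSPACE_def NSPACE_def by blast

lemma constant_time_DSPACE:
  assumes "constant_time A" "(\<lambda>_. 1) \<in> O(f)"
  shows "A \<in> DSPACE f"
proof -
  obtain M c where "deterministic M" "runs_in_time M (\<lambda>_. c)" "recognized M = A"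
    using assms(1) by (auto simp: constant_time_def)
  moreover from this(2) have "runs_in_space M (\<lambda>_. c + 1)" by (rule runs_in_time_imp_space)
  moreover have "(\<lambda>n. real (c + 1)) \<in> O(f)"
    by (rule landau_o.big_trans[OF bigo_const assms(2)])
  ultimately show ?thesis
    unfolding DSPACE_def by (intro CollectI exI[of _ M] exI[of _ "\<lambda>_. c + 1"]) auto
qed

lemma one_bigo_ln: "(\<lambda>_. 1) \<in> O(\<lambda>n::nat. ln (real n))"
proof (rule bigoI[of _ 1])
  show "\<forall>\<^sub>F n in at_top. norm (1 :: real) \<le> 1 * norm (ln (real n))"
  \<comment> \<open>From \<open>3\<close> on, \<open>real n\<close> is at least
    \<open>exp 1\<close>, so its logarithm is at least \<open>1\<close>.\<close>
  proof (rule eventually_mono[OF eventually_ge_at_top[of 3]])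
    fix n :: nat assume "3 \<le> n"
    then have "exp 1 \<le> real n" using exp_le by linarith
    then have "1 \<le> ln (real n)" using \<open>3 \<le> n\<close> by (simp add: ln_ge_iff)
    then show "norm (1 :: real) \<le> 1 * norm (ln (real n))" by simp
  qed
qed

lemma constant_time_P: "constant_time A \<Longrightarrow> A \<in> class_P"
  unfolding class_P_def by (intro UN_I[of 0] constant_time_DTIME) simp_all

lemma constant_time_NP: "constant_time A \<Longrightarrow> A \<in> class_NP"
  unfolding class_NP_def
  by (intro UN_I[of 0] subsetD[OF DTIME_subset_NTIME] constant_time_DTIME) simp_all

lemma constant_time_EXP: "constant_time A \<Longrightarrow> A \<in> class_EXP"
  unfolding class_EXP_def by (intro UN_I[of 0] constant_time_DTIME) simp_all

lemma constant_time_PSPACE: "constant_time A \<Longrightarrow> A \<in> class_PSPACE"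
  unfolding class_PSPACE_def by (intro UN_I[of 0] constant_time_DSPACE) simp_all

lemma constant_time_L: "constant_time A \<Longrightarrow> A \<in> class_L"
  unfolding class_L_def by (intro constant_time_DSPACE one_bigo_ln)

lemma constant_time_NL: "constant_time A \<Longrightarrow> A \<in> class_NL"
  unfolding class_NL_def
  by (intro subsetD[OF DSPACE_subset_NSPACE] constant_time_DSPACE one_bigo_ln)

lemma finite_coNP: "finite A \<Longrightarrow> A \<in> class_coNP"
  unfolding class_coNP_def by (simp add: constant_time_NP constant_time_cofinite)

text \<open>The mark before each position tells whether the first component has ended, so it can be
  decoded bit by bit.\<close>

lemma inj_encode_tuple_pair_Nil: "inj (\<lambda>x. encode_tuple [x, []])"
proof (rule injI)
  fix x y show "encode_tuple [x, []] = encode_tuple [y, []] \<Longrightarrow> x = y"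
  proof (induction x arbitrary: y)
    case Nil
    then show ?case by (cases y) (auto simp: encode_tuple_def)
  next
    case (Cons b x)
    then show ?case by (cases y) (auto simp: encode_tuple_def)
  qed
qed

lemma finite_PH:
  assumes "finite A"
  shows "A \<in> class_PH"
proof -
  \<comment> \<open>The hierarchy starts at level \<open>1\<close>, so one quantifier is present;
    the zero polynomial leaves the empty string as its only value.\<close>
  define B where "B = (\<lambda>x. encode_tuple [x, []]) ` A"
  have "A = {x. alternation True 1 (poly (0 :: nat poly) (length x)) (\<lambda>us. encode_tuple us \<in> B) [x]}"
    unfolding B_def using inj_encode_tuple_pair_Nil by (auto dest: injD)
  moreover have "B \<in> class_P"
    unfolding B_def using assms by (intro constant_time_P constant_time_finite finite_imageI)
  ultimately have "A \<in> SigmaP 1" unfolding SigmaP_def by blast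
  then show ?thesis unfolding class_PH_def by auto
qed

section \<open>Reversible circuits\<close>

fun gate_map :: "gate \<Rightarrow> bool list \<Rightarrow> bool list" where
  "gate_map (PauliX i) s = s[i := (\<not> s ! i)]"
| "gate_map (CNot i j) s = s[j := (s ! j \<noteq> s ! i)]"
| "gate_map (Toffoli i j k) s = s[k := (s ! k \<noteq> (s ! i \<and> s ! j))]"
| "gate_map _ s = s"

fun permutation_gate :: "gate \<Rightarrow> bool" where
  "permutation_gate (Hadamard i) = False"
| "permutation_gate (PhaseT i) = False"
| "permutation_gate _ = True"

lemma length_gate_map [simp]: "length (gate_map g s) = length s"
  by (cases g) auto

text \<open>Distinct wires leave the controls untouched, so the second application undoes the first.
  An update at a position beyond the list does nothing.\<close>

lemma gate_map_involution:
  assumes "distinct (qubits g)"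
  shows "gate_map g (gate_map g s) = s"
proof (cases g)
  case (PauliX i)
  then show ?thesis by (cases "i < length s")
      (auto simp: list_update_beyond nth_list_update intro!: nth_equalityI split: if_splits)
next
  case (CNot i j)
  then show ?thesis using assms by (cases "j < length s")
      (auto simp: list_update_beyond nth_list_update intro!: nth_equalityI split: if_splits)
next
  case (Toffoli i j k)
  then show ?thesis using assms by (cases "k < length s")
      (auto simp: list_update_beyond nth_list_update intro!: nth_equalityI split: if_splits)
qed auto

text \<open>The gate composes the amplitudes with \<open>gate_map g\<close>, which moves the peak to
  the preimage of \<open>s\<close>; for an involution this is the image.\<close>

lemma apply_gate_basis_state:
  assumes "permutation_gate g" "distinct (qubits g)"
  shows "apply_gate g (\<lambda>b. if b = s then 1 else 0) = (\<lambda>b. if b = gate_map g s then 1 else 0)"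
proof -
  have "apply_gate g \<psi> = (\<lambda>b. \<psi> (gate_map g b))" for \<psi>
    using assms(1) by (cases g) auto
  moreover have "gate_map g b = s \<longleftrightarrow> b = gate_map g s" for b
    using gate_map_involution[OF assms(2)] by metis
  ultimately show ?thesis by simp
qed

definition run_gates :: "gate list \<Rightarrow> bool list \<Rightarrow> bool list" where
  "run_gates gs s = fold gate_map gs s"

lemma run_gates_simps [simp]:
  "run_gates [] s = s"
  "run_gates (g # gs) s = run_gates gs (gate_map g s)"
  "run_gates (gs @ hs) s = run_gates hs (run_gates gs s)"
  by (simp_all add: run_gates_def)

lemma length_run_gates [simp]: "length (run_gates gs s) = length s"
  by (induction gs arbitrary: s) auto

definition permutation_gates :: "nat \<Rightarrow> gate list \<Rightarrow> bool" where
  "permutation_gates m gs \<longleftrightarrow>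
     (\<forall>g\<in>set gs. permutation_gate g \<and> distinct (qubits g) \<and> (\<forall>i\<in>set (qubits g). i < m))"

lemma fold_apply_gate_basis_state:
  assumes "permutation_gates m gs"
  shows "fold apply_gate gs (\<lambda>b. if b = s then 1 else 0) = (\<lambda>b. if b = run_gates gs s then 1 else 0)"
  using assms
proof (induction gs arbitrary: s)
  case (Cons g gs)
  then have "permutation_gate g" "distinct (qubits g)" "permutation_gates m gs"
    by (auto simp: permutation_gates_def)
  with Cons.IH[of "gate_map g s"] show ?case by (simp add: apply_gate_basis_state)
qed simp

text \<open>Basis states stay basis states, so at most one term of the sum is nonzero, and it is
  \<open>1\<close>.\<close>

lemma accept_prob_permutation_circuit:
  assumes "permutation_gates (length x + m) gs"
  shows "accept_prob (Circuit m gs) x =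
    (if run_gates gs (x @ replicate m False) ! length x then 1 else 0)"
proof -
  let ?s = "run_gates gs (x @ replicate m False)"
  let ?B = "{b :: bool list. length b = length x + m \<and> b ! length x}"
  have "finite ?B"
    by (rule finite_subset[OF _ finite_lists_length_eq[of "UNIV :: bool set" "length x + m"]]) auto
  have "accept_prob (Circuit m gs) x = (\<Sum>b\<in>?B. (cmod (if b = ?s then 1 else 0))\<^sup>2)"
    unfolding accept_prob_def output_state_def input_state_def circuit.sel
    by (simp add: fold_apply_gate_basis_state[OF assms])
  also have "\<dots> = (\<Sum>b\<in>?B. if b = ?s then 1 else 0)"
    by (intro sum.cong) auto
  also have "\<dots> = (if ?s \<in> ?B then 1 else 0)"
    using \<open>finite ?B\<close> by simp
  finally show ?thesis by simp
qed

text \<open>Wire \<open>k\<close> is the output and the wires \<open>k, ..., k + m - 1\<close> are fresh ancillas; since all other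
  wires are restored, subcircuits on disjoint blocks of ancillas compose.\<close>

definition implements ::
  "nat \<Rightarrow> (bool list \<Rightarrow> bool) \<Rightarrow> nat \<Rightarrow> nat \<Rightarrow> gate list \<Rightarrow> bool" where
  "implements n p k m gs \<longleftrightarrow> permutation_gates (k + m) gs \<and> m > 0 \<and>
     (\<forall>s. k + m \<le> length s \<longrightarrow> (\<forall>i. k \<le> i \<longrightarrow> i < k + m \<longrightarrow> \<not> s ! i) \<longrightarrow>
        run_gates gs s ! k = p (take n s) \<and>
        (\<forall>i. i < k \<or> k + m \<le> i \<longrightarrow> run_gates gs s ! i = s ! i))"

text \<open>The position \<open>k\<close> is arbitrary so that a subcircuit can be placed behind any
  wires already in use.\<close>

definition circuit_computable :: "nat \<Rightarrow> (bool list \<Rightarrow> bool) \<Rightarrow> bool" where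
  "circuit_computable n p \<longleftrightarrow> (\<forall>k\<ge>n. \<exists>m gs. implements n p k m gs)"

lemma permutation_gates_mono: "permutation_gates m gs \<Longrightarrow> m \<le> l \<Longrightarrow> permutation_gates l gs"
  by (fastforce simp: permutation_gates_def)

lemma permutation_gates_append [simp]: "permutation_gates m (gs @ hs) \<longleftrightarrow> permutation_gates m gs \<and> permutation_gates m hs"
  by (auto simp: permutation_gates_def)

lemma circuit_computable_cong:
  assumes "circuit_computable n p" "\<And>u. length u = n \<Longrightarrow> p u = q u"
  shows "circuit_computable n q"
  unfolding circuit_computable_def
proof (intro allI impI)
  fix k assume "n \<le> k"
  then obtain m gs where "implements n p k m gs" using assms(1) by (auto simp: circuit_computable_def)
  moreover have "p (take n s) = q (take n s)" if "k + m \<le> length s" for s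
    using assms(2) \<open>n \<le> k\<close> that by simp
  ultimately have "implements n q k m gs" by (auto simp: implements_def)
  then show "\<exists>m gs. implements n q k m gs" by blast
qed

lemma circuit_computable_False: "circuit_computable n (\<lambda>_. False)"
  unfolding circuit_computable_def
proof (intro allI impI exI)
  fix k show "implements n (\<lambda>_. False) k 1 []"
    by (auto simp: implements_def permutation_gates_def)
qed

lemma circuit_computable_nth:
  assumes "i < n"
  shows "circuit_computable n (\<lambda>u. u ! i)"
  unfolding circuit_computable_def
proof (intro allI impI exI)
  fix k assume "n \<le> k"
  \<comment> \<open>A controlled not onto a wire holding \<open>False\<close> copies the input
    bit.\<close>
  then show "implements n (\<lambda>u. u ! i) k 1 [CNot i k]"
    using assms by (auto simp: implements_def permutation_gates_def nth_list_update)
qed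

lemma circuit_computable_Not:
  assumes "circuit_computable n p"
  shows "circuit_computable n (\<lambda>u. \<not> p u)"
  unfolding circuit_computable_def
proof (intro allI impI)
  fix k assume "n \<le> k"
  then obtain m gs where *: "implements n p k m gs" using assms by (auto simp: circuit_computable_def)
  then have "implements n (\<lambda>u. \<not> p u) k m (gs @ [PauliX k])"
    by (auto simp: implements_def permutation_gates_def nth_list_update)
  then show "\<exists>m gs. implements n (\<lambda>u. \<not> p u) k m gs" by blast
qed

text \<open>Wire \<open>k\<close> is kept for the result, the two subcircuits get consecutive blocks
  behind it, and a Toffoli gate combines their outputs. The blocks may keep garbage, as only wires
  outside them must be restored.\<close>

lemma circuit_computable_conj:
  assumes "circuit_computable n p" "circuit_computable n q"
  shows "circuit_computable n (\<lambda>u. p u \<and> q u)"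
  unfolding circuit_computable_def
proof (intro allI impI)
  fix k assume k: "n \<le> k"
  obtain m1 gs where 1: "implements n p (Suc k) m1 gs"
    using assms(1) k unfolding circuit_computable_def by (metis le_SucI)
  obtain m2 hs where 2: "implements n q (Suc k + m1) m2 hs"
    using assms(2) k unfolding circuit_computable_def by (metis le_SucI trans_le_add1)
  let ?m = "Suc (m1 + m2)" and ?gs = "gs @ hs @ [Toffoli (Suc k) (Suc k + m1) k]"
  \<comment> \<open>Nonempty blocks make the two controls distinct and keep the second one within
    the \<open>?m\<close> wires.\<close>
  have m: "m1 > 0" "m2 > 0" using 1 2 by (auto simp: implements_def)
  have "implements n (\<lambda>u. p u \<and> q u) k ?m ?gs"
    unfolding implements_def
  proof (intro conjI allI impI)
    have "permutation_gates (Suc k + m1) gs" "permutation_gates (Suc k + m1 + m2) hs"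
      using 1 2 by (auto simp: implements_def)
    then have "permutation_gates (k + ?m) gs" "permutation_gates (k + ?m) hs"
      by (auto elim: permutation_gates_mono)
    then show "permutation_gates (k + ?m) ?gs" using m by (auto simp: permutation_gates_def)
    show "?m > 0" by simp
    fix s :: "bool list" assume len: "k + ?m \<le> length s" and zero: "\<forall>i. k \<le> i \<longrightarrow> i < k + ?m \<longrightarrow> \<not> s ! i"
    define s1 where "s1 = run_gates gs s"
    define s2 where "s2 = run_gates hs s1"
    have s1: "s1 ! Suc k = p (take n s)" "\<And>i. i < Suc k \<or> Suc k + m1 \<le> i \<Longrightarrow> s1 ! i = s ! i"
      using 1 len zero unfolding implements_def s1_def by auto
    have [simp]: "length s1 = length s" "length s2 = length s" by (simp_all add: s1_def s2_def)
    \<comment> \<open>The first subcircuit changes neither the input nor the second block, so the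
      second one starts from the same input and clean ancillas.\<close>
    have "take n s1 = take n s"
      using s1(2) k len by (intro nth_equalityI) auto
    moreover have "\<forall>i. Suc k + m1 \<le> i \<longrightarrow> i < Suc k + m1 + m2 \<longrightarrow> \<not> s1 ! i"
      using s1(2) zero by auto
    ultimately have s2: "s2 ! (Suc k + m1) = q (take n s)"
      "\<And>i. i < Suc k + m1 \<or> Suc k + m1 + m2 \<le> i \<Longrightarrow> s2 ! i = s1 ! i"
      using 2 len unfolding implements_def s2_def by auto
    have run: "run_gates ?gs s = s2[k := (s2 ! k \<noteq> (s2 ! Suc k \<and> s2 ! (Suc k + m1)))]"
      by (simp add: s1_def s2_def)
    show "run_gates ?gs s ! k = (p (take n s) \<and> q (take n s))"
      unfolding run using s1 s2 m len zero by simp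
    show "run_gates ?gs s ! i = s ! i" if "i < k \<or> k + ?m \<le> i" for i
      unfolding run using s1(2)[of i] s2(2)[of i] that by auto
  qed
  then show "\<exists>m gs. implements n (\<lambda>u. p u \<and> q u) k m gs" by blast
qed

lemma circuit_computable_prefix_eq:
  assumes "l \<le> n"
  shows "circuit_computable n (\<lambda>u. \<forall>i<l. u ! i = a ! i)"
  using assms
proof (induction l)
  case 0
  show ?case using circuit_computable_Not[OF circuit_computable_False[of n]] by simp
next
  case (Suc l)
  have "circuit_computable n (\<lambda>u. u ! l = a ! l)"
    using circuit_computable_nth[of l n] circuit_computable_Not[OF circuit_computable_nth[of l n]] Suc.prems
    by (cases "a ! l") simp_all
  with Suc have "circuit_computable n (\<lambda>u. (\<forall>i<l. u ! i = a ! i) \<and> u ! l = a ! l)"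
    by (intro circuit_computable_conj) simp_all
  then show ?case by (rule circuit_computable_cong) (auto simp: less_Suc_eq)
qed

lemma circuit_computable_mem:
  assumes "finite S"
  shows "circuit_computable n (\<lambda>u. u \<in> S)"
  using assms
proof (induction S)
  case empty
  show ?case using circuit_computable_False by simp
next
  case (insert a S)
  have eq: "circuit_computable n (\<lambda>u. u = a)"
  proof (cases "length a = n")
    case True
    show ?thesis
      by (rule circuit_computable_cong[OF circuit_computable_prefix_eq[of n n a]]) (auto simp: True list_eq_iff_nth_eq)
  next
    case False
    then show ?thesis by (intro circuit_computable_cong[OF circuit_computable_False]) auto
  qed
  \<comment> \<open>Disjunction by De Morgan from negation and conjunction.\<close>
  have "circuit_computable n (\<lambda>u. \<not> (\<not> u = a \<and> \<not> u \<in> S))"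
    by (intro circuit_computable_Not circuit_computable_conj eq insert.IH)
  then show ?case by (rule circuit_computable_cong) auto
qed

section \<open>Finite languages in BQP\<close>

lemma circuit_for_finite_language:
  assumes "finite A"
  obtains Q where "wf_circuit n Q" "\<And>x. length x = n \<Longrightarrow> accept_prob Q x = (if x \<in> A then 1 else 0)"
proof -
  \<comment> \<open>Placing the result at wire \<open>n\<close> makes it the first ancilla, where a
    circuit delivers its output.\<close>
  obtain m gs where impl: "implements n (\<lambda>u. u \<in> A) n m gs"
    using circuit_computable_mem[OF assms, of n] unfolding circuit_computable_def by blast
  then have good: "permutation_gates (n + m) gs" and "m > 0" by (auto simp: implements_def)
  show ?thesis
  proof (rule that[of "Circuit m gs"])
    show "wf_circuit n (Circuit m gs)"
      using good \<open>m > 0\<close> by (auto simp: wf_circuit_def permutation_gates_def)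
    fix x :: "bool list" assume len: "length x = n"
    have "run_gates gs (x @ replicate m False) ! n = (take n (x @ replicate m False) \<in> A)"
      using impl len unfolding implements_def by (auto simp: nth_append)
    then show "accept_prob (Circuit m gs) x = (if x \<in> A then 1 else 0)"
      using accept_prob_permutation_circuit[of x m gs] good len by simp
  qed
qed

lemma finite_BQP:
  assumes "finite A"
  shows "A \<in> class_BQP"
proof -
  obtain K where K: "\<forall>x\<in>A. length x < K"
    by (rule finite_language_prefix[OF assms])
  have "\<forall>n. \<exists>Q. wf_circuit n Q \<and> (\<forall>x. length x = n \<longrightarrow> accept_prob Q x = (if x \<in> A then 1 else 0))"
    using circuit_for_finite_language[OF assms] by metis
  then obtain R where R: "\<And>n. wf_circuit n (R n)"
    "\<And>n x. length x = n \<Longrightarrow> accept_prob (R n) x = (if x \<in> A then 1 else 0)"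
    by metis
  \<comment> \<open>From length \<open>K\<close> on, a single untouched ancilla rejects. The circuit
    thus depends only on \<open>min K n\<close>, so a machine that looks at \<open>K\<close> input
    bits can write its description from a finite table.\<close>
  define Q where "Q n = (if n < K then R n else Circuit 1 [])" for n
  have wf: "wf_circuit n (Q n)" for n
    using R(1) by (simp add: Q_def wf_circuit_def)
  have prob: "accept_prob (Q (length x)) x = (if x \<in> A then 1 else 0)" for x
  proof (cases "length x < K")
    case True
    then show ?thesis using R(2) by (simp add: Q_def)
  next
    case False
    then have "x \<notin> A" using K by blast
    then show ?thesis
      using False accept_prob_permutation_circuit[of x 1 "[]"] by (simp add: Q_def permutation_gates_def)
  qed
  obtain M c where M: "deterministic M" "runs_in_time M (\<lambda>_. c)"
    "\<forall>x. outputs M x (encode_circuit (Q (length (take K x))))"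
    by (rule prefix_transducer[where V = "\<lambda>_. True" and W = "\<lambda>u. encode_circuit (Q (length u))" and K = K])
  have "outputs M (replicate n True) (encode_circuit (Q n))" for n
  proof -
    have "Q (min K n) = Q n" by (simp add: Q_def min_def)
    then show ?thesis using M(3)[rule_format, of "replicate n True"] by (simp add: min.commute)
  qed
  moreover have "(\<lambda>n. real c) \<in> O(\<lambda>n. real n ^ 0)" by simp
  ultimately have "poly_uniform Q"
    unfolding poly_uniform_def using M(1,2) by blast
  then show ?thesis
    unfolding class_BQP_def using wf prob by auto
qed

section \<open>Countability of the classes\<close>

instance direction :: countable by countable_datatype
instance input_symbol :: countable by countable_datatype
instance machine :: countable by countable_datatype

lemma countable_recognized: "countable (range recognized)"
  by simp

lemma countable_NP: "countable class_NP"
  by (rule countable_subset[OF _ countable_recognized]) (auto simp: class_NP_def NTIME_def)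

lemma countable_P: "countable class_P"
  by (rule countable_subset[OF _ countable_recognized]) (auto simp: class_P_def DTIME_def)

lemma countable_EXP: "countable class_EXP"
  by (rule countable_subset[OF _ countable_recognized]) (auto simp: class_EXP_def DTIME_def)

lemma countable_PSPACE: "countable class_PSPACE"
  by (rule countable_subset[OF _ countable_recognized]) (auto simp: class_PSPACE_def DSPACE_def)

lemma countable_L: "countable class_L"
  by (rule countable_subset[OF _ countable_recognized]) (auto simp: class_L_def DSPACE_def)

lemma countable_NL: "countable class_NL"
  by (rule countable_subset[OF _ countable_recognized]) (auto simp: class_NL_def NSPACE_def)

lemma countable_coNP: "countable class_coNP"
proof (rule countable_subset)
  show "class_coNP \<subseteq> uminus ` class_NP"
    by (metis class_coNP_def double_compl imageI mem_Collect_eq subsetI)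
  show "countable (uminus ` class_NP)" by (intro countable_image countable_NP)
qed

lemma countable_poly: "countable (UNIV :: 'a::{countable, zero} poly set)"
  by (rule countableI'[of "to_nat \<circ> coeffs"]) (auto intro!: inj_onI simp: coeffs_eq_iff)

lemma countable_SigmaP: "countable (SigmaP i)"
proof (rule countable_subset)
  let ?f = "\<lambda>(B, q :: nat poly).
    {x. alternation True i (poly q (length x)) (\<lambda>us. encode_tuple us \<in> B) [x]}"
  show "SigmaP i \<subseteq> ?f ` (class_P \<times> UNIV)" unfolding SigmaP_def by auto
  show "countable (?f ` (class_P \<times> UNIV))"
    by (intro countable_image countable_SIGMA countable_P countable_poly)
qed

lemma countable_PH: "countable class_PH"
  unfolding class_PH_def by (intro countable_UN countable_SigmaP) simp

section \<open>Unique decoding of circuits and outputs\<close>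

lemma encode_nat_append_inject [simp]:
  "encode_nat m @ u = encode_nat n @ v \<longleftrightarrow> m = n \<and> u = v"
proof (induction m arbitrary: n)
  case 0
  show ?case by (cases n) (auto simp: encode_nat_def)
next
  case (Suc m)
  then show ?case by (cases n) (auto simp: encode_nat_def)
qed

text \<open>Unary numbers closed by \<open>False\<close> form a prefix-free code; the leading one
  names the kind of gate and so how many wire numbers follow.\<close>

lemma encode_gate_append_inject:
  "encode_gate g @ u = encode_gate h @ v \<longleftrightarrow> g = h \<and> u = v"
  by (cases g; cases h; simp)

lemma encode_gate_neq_Nil: "encode_gate g \<noteq> []"
  by (cases g) (auto simp: encode_nat_def)

lemma inj_encode_circuit: "inj encode_circuit"
proof (rule injI)
  have "gs = hs" if "concat (map encode_gate gs) = concat (map encode_gate hs)" for gs hs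
    using that
  proof (induction gs arbitrary: hs)
    case Nil
    then show ?case by (cases hs) (auto simp: encode_gate_neq_Nil)
  next
    case (Cons g gs)
    then show ?case by (cases hs) (auto simp: encode_gate_neq_Nil encode_gate_append_inject)
  qed
  then show "encode_circuit Q = encode_circuit Q' \<Longrightarrow> Q = Q'" for Q Q'
    by (cases Q; cases Q') (simp add: encode_circuit_def)
qed

lemma inj_tape_of_string: "inj tape_of_string"
proof (rule injI)
  fix u v assume eq: "tape_of_string u = tape_of_string v"
  \<comment> \<open>Bits are written as \<open>1\<close> and \<open>2\<close>, so the first blank
    marks the end of the string.\<close>
  have iff: "i < length w \<longleftrightarrow> tape_of_string w i \<noteq> 0" for w i
    by (simp add: tape_of_string_def)
  have len: "length u = length v"
    using iff[of _ u] iff[of _ v] eq by (metis nat_neq_iff)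
  show "u = v"
  proof (rule nth_equalityI[OF len])
    fix i assume "i < length u"
    with len fun_cong[OF eq, of i] show "u ! i = v ! i"
      by (simp add: tape_of_string_def split: if_splits)
  qed
qed

lemma outputs_unique:
  assumes "deterministic M" "outputs M x u" "outputs M x v"
  shows "u = v"
proof -
  have "tape_of_string u = tape_of_string v"
    using assms reachable_halted_unique unfolding outputs_def by metis
  then show ?thesis using inj_tape_of_string by (simp add: inj_eq)
qed

lemma countable_BQP: "countable class_BQP"
proof (rule countable_subset)
  \<comment> \<open>Circuit families need not be countable in number, so languages are indexed by
    the machines that generate the families.\<close>
  let ?g = "\<lambda>M. {x. \<exists>q. outputs M (replicate (length x) True) (encode_circuit q) \<and> accept_prob q x \<ge> 2 / 3}"
  show "class_BQP \<subseteq> range ?g"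
  proof
    fix A assume "A \<in> class_BQP"
    then obtain Q where uni: "poly_uniform Q"
      and yes: "\<forall>x\<in>A. accept_prob (Q (length x)) x \<ge> 2 / 3"
      and no: "\<forall>x\<in>- A. accept_prob (Q (length x)) x \<le> 1 / 3"
      unfolding class_BQP_def by blast
    from uni obtain M where M: "deterministic M"
      "\<And>n. outputs M (replicate n True) (encode_circuit (Q n))"
      unfolding poly_uniform_def by blast
    \<comment> \<open>Determinism and injectivity of the encoding force the existential circuit in
      \<open>?g M\<close> to be the one from the family.\<close>
    have Q: "q = Q n" if "outputs M (replicate n True) (encode_circuit q)" for q n
      using outputs_unique[OF M(1) that M(2)] inj_encode_circuit by (simp add: inj_eq)
    have "x \<in> A \<longleftrightarrow> x \<in> ?g M" for x
    proof
      assume "x \<in> A"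
      then show "x \<in> ?g M" using M(2) yes by auto
    next
      assume "x \<in> ?g M"
      then have "accept_prob (Q (length x)) x \<ge> 2 / 3" using Q by auto
      \<comment> \<open>The gap between \<open>1 / 3\<close> and \<open>2 / 3\<close> lets the
        single threshold in \<open>?g\<close> recover \<open>A\<close>.\<close>
      moreover have "accept_prob (Q (length x)) x \<le> 1 / 3" if "x \<notin> A" using no that by blast
      ultimately show "x \<in> A" by fastforce
    qed
    then have "A = ?g M" by blast
    then show "A \<in> range ?g" by blast
  qed
  show "countable (range ?g)" by simp
qed

theorem theorem2p16:
  assumes "C \<in> {class_NP, class_EXP, class_coNP, class_BQP, class_PH, class_L, class_NL, class_PSPACE}"
  shows "Sigma02_complete (cantor_set C) \<and> fsigma (cantor_set C) \<and> \<not> gdelta (cantor_set C)"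
proof -
  have "countable C"
    using assms countable_NP countable_EXP countable_coNP countable_BQP countable_PH countable_L
      countable_NL countable_PSPACE by blast
  then have "countable (cantor_set C)" by (simp add: cantor_set_def)
  moreover have "A \<in> C" if "finite A" for A
  proof -
    have "constant_time A" using that by (rule constant_time_finite)
    then show ?thesis
      using assms constant_time_NP constant_time_EXP finite_coNP[OF that] finite_BQP[OF that]
        finite_PH[OF that] constant_time_L constant_time_NL constant_time_PSPACE by blast
  qed
  then have "{x. finite {n. x n}} \<subseteq> cantor_set C"
    using finite_cantor_set by blast
  ultimately show ?thesis using countable_Sigma02_complete by blast
qed

end
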